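(* For any $k\in\mathbb{N}$, $\displaystyle\lim_{n\to\infty}\rho_k^n=1+c_k$.
   Context: Let $\mathcal{C}$ be the unit circle in the Euclidean plane centered at the origin. For $n,k\in\mathbb{N}$, $k$ treasures are hidden at unknown points $\mathbf{T}=(T_1,\dots,T_k)\in\mathcal{C}^k$, and $n$ robots start at time $0$ at the origin. Each robot moves independently anywhere in the plane (not restricted to $\mathcal{C}$) with speed at most $1$. A treasure is discovered when the position of some robot coincides with it; upon discovery all robots instantly learn its location. A strategy specifies the motion of all $n$ robots, where at each time the motion may depend only on the information about treasures discovered so far; $\mathcal{S}_k^n$ is the set of all valid strategies for $n$ robots and $k$ treasures. For $S\in\mathcal{S}_k^n$ let $\rho_S(\mathbf{T})$ be the time required until every robot has individually visited (been at the location of) every treasure. Define $$\rho_k^n=\inf_{S\in\mathcal{S}_k^n}\ \sup_{\mathbf{T}\in\mathcal{C}^k}\rho_S(\mathbf{T}).$$ Separately, let $R=(1,0)$ and let $d(\cdot,\cdot)$ denote Euclidean distance. For $k\in\mathbb{N}$ define $$c_k=\sup_{(T_1,\dots,T_k)\in\mathcal{C}^k}\ \min_\sigma\Big(d(R,T_{\sigma(1)})+\sum_{i=2}^k d(T_{\sigma(i-1)},T_{\sigma(i)})\Big),$$ the minimum being over all permutations $\sigma$ of $\{1,\dots,k\}$. *)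

theory Defs
  imports "HOL-Analysis.Analysis" "HOL-Library.Multiset" "HOL-Combinatorics.Permutations"
begin

text \<open>The Euclidean plane is identified with \<^typ>\<open>complex\<close>, so that the point
  R = (1,0) is \<^term>\<open>1 :: complex\<close>. Treasures are numbered 1 to k and robots 1 to n.\<close>

definition placements :: "nat \<Rightarrow> (nat \<Rightarrow> complex) set" where
  "placements k = {1..k} \<rightarrow>\<^sub>E sphere 0 1"

type_synonym motion = "nat \<Rightarrow> real \<Rightarrow> complex"

text \<open>The locations known to all robots at time t if the robots move according to X.
  Treasures may share a location, and each of them is discovered individually; hence the multiset.\<close>

definition known :: "nat \<Rightarrow> nat \<Rightarrow> motion \<Rightarrow> (nat \<Rightarrow> complex) \<Rightarrow> real \<Rightarrow> complex multiset" where
  "known n k X T t =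
     {#T j. j \<in># mset_set {j \<in> {1..k}. \<exists>i\<in>{1..n}. \<exists>s\<in>{0..t}. X i s = T j}#}"

text \<open>A strategy is represented by its outcome: it assigns to every placement T the motion of
  all robots that results when the treasures are hidden at T. That the robots act only on what has
  been discovered so far is the last condition: the position at time t is the same for any two
  placements that produce the same history of discoveries (locations and times) during [0,t].\<close>

definition strategies :: "nat \<Rightarrow> nat \<Rightarrow> ((nat \<Rightarrow> complex) \<Rightarrow> motion) set" where
  "strategies n k = {S.
     (\<forall>T\<in>placements k. \<forall>i\<in>{1..n}. S T i 0 = 0 \<and> 1-lipschitz_on {0..} (S T i)) \<and>
     (\<forall>T\<in>placements k. \<forall>T'\<in>placements k. \<forall>t\<ge>0.
        (\<forall>s\<in>{0..t}. known n k (S T) T s = known n k (S T') T' s) \<longrightarrow>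
        (\<forall>i\<in>{1..n}. S T i t = S T' i t))}"

text \<open>The value is infinite if some robot never visits some treasure.\<close>

definition completion_time :: "nat \<Rightarrow> nat \<Rightarrow> motion \<Rightarrow> (nat \<Rightarrow> complex) \<Rightarrow> ereal" where
  "completion_time n k X T =
     Inf {ereal t |t. 0 \<le> t \<and> (\<forall>i\<in>{1..n}. \<forall>j\<in>{1..k}. \<exists>s\<in>{0..t}. X i s = T j)}"

definition rho :: "nat \<Rightarrow> nat \<Rightarrow> ereal" where
  "rho n k = (INF S\<in>strategies n k. SUP T\<in>placements k. completion_time n k (S T) T)"

definition route_length :: "nat \<Rightarrow> (nat \<Rightarrow> complex) \<Rightarrow> (nat \<Rightarrow> nat) \<Rightarrow> real" where
  "route_length k T p = dist 1 (T (p 1)) + (\<Sum>i=2..k. dist (T (p (i - 1))) (T (p i)))"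

definition c :: "nat \<Rightarrow> real" where
  "c k = (SUP T\<in>placements k. MIN p\<in>{p. p permutes {1..k}}. route_length k T p)"

end

theory Submission
  imports Defs
begin

text \<open>Upper bound: the n robots walk to equally spaced points of the circle and sweep it
  in additional time \<open>2 * pi / n\<close>; then all treasures are known, and by rotational
  symmetry every robot can visit all of them within time \<open>c k\<close>.

  Lower bound: as long as no robot has touched the circle, the motion does not depend on the
  placement. The robot that is the first to touch it, at a point P and at a time \<open>\<ge> 1\<close>, faces an
  arbitrary rotated placement, rotated so that R becomes P, and thus needs additional time \<open>c k\<close>.\<close>

section \<open>Curves of speed at most one\<close>

text \<open>A chord is at most as long as its arc, since \<open>2 * sin (x / 2)\<close> is at most
  \<open>x\<close> in absolute value. Hence sweeping the circle at unit angular speed respects the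
  speed limit.\<close>

lemma dist_cis_le: "dist (cis a) (cis b) \<le> \<bar>a - b\<bar>"
proof -
  have "cis a - cis b = cis b * (cis (a - b) - 1)"
    by (simp add: algebra_simps cis_mult)
  hence "dist (cis a) (cis b) = dist (cis (a - b)) 1"
    by (simp add: dist_norm norm_mult)
  also have "\<dots> = 2 * \<bar>sin ((a - b) / 2)\<bar>"
    using dist_exp_i_1[of "a - b"] by (simp add: cis_conv_exp dist_norm)
  also have "\<dots> \<le> 2 * \<bar>(a - b) / 2\<bar>"
    using abs_sin_x_le_abs_x[of "(a - b) / 2"] by linarith
  finally show ?thesis by simp
qed

lemma lipschitz_on_atLeast_concat:
  fixes a b :: real
  assumes "L-lipschitz_on {a..b} f" "L-lipschitz_on {b..} g" "f b = g b"
  shows "L-lipschitz_on {a..} (\<lambda>x. if x \<le> b then f x else g x)"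
proof (rule lipschitz_onI)
  show "0 \<le> L" using assms(1) lipschitz_on_nonneg by blast
  fix x y assume xy: "x \<in> {a..}" "y \<in> {a..}"
  have "L-lipschitz_on {a..max x y} (\<lambda>x. if x \<le> b then f x else g x)"
    by (rule lipschitz_on_concat)
       (use assms in \<open>auto intro: lipschitz_on_subset\<close>)
  thus "dist (if x \<le> b then f x else g x) (if y \<le> b then f y else g y) \<le> L * dist x y"
    by (rule lipschitz_onD) (use xy in auto)
qed

text \<open>Traversing the polygon at unit speed reaches vertex \<open>m\<close> at the arc length
  \<open>l m\<close>. The induction appends one segment at a time; the clause on
  \<open>g (l m)\<close> is what makes the gluing possible.\<close>

lemma polygonal_path:
  fixes q :: "nat \<Rightarrow> 'a::real_normed_vector"
  defines "l \<equiv> \<lambda>m. \<Sum>i<m. dist (q i) (q (Suc i))"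
  shows "\<exists>g. g 0 = q 0 \<and> 1-lipschitz_on {0..} g \<and> g (l m) = q m \<and>
    (\<forall>i\<le>m. \<exists>s\<in>{0..l m}. g s = q i)"
proof (induction m)
  case 0
  have "1-lipschitz_on {0::real..} (\<lambda>_. q 0)" by (auto intro!: lipschitz_onI)
  thus ?case by (intro exI[of _ "\<lambda>_. q 0"]) (auto simp: l_def)
next
  case (Suc m)
  then obtain g where g: "g 0 = q 0" "1-lipschitz_on {0..} g" "g (l m) = q m"
    "\<forall>i\<le>m. \<exists>s\<in>{0..l m}. g s = q i" by blast
  \<comment> \<open>The direction of the new segment; it is 0 if the two vertices coincide, and then
    \<open>h\<close> is constant.\<close>
  define u where "u = sgn (q (Suc m) - q m)"
  define h where "h = (\<lambda>t. q m + (t - l m) *\<^sub>R u)"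
  have l0: "0 \<le> l m" by (auto simp: l_def intro: sum_nonneg)
  have lSuc: "l (Suc m) = l m + dist (q m) (q (Suc m))" by (simp add: l_def)
  have hL: "1-lipschitz_on {l m..} h"
  proof (rule lipschitz_onI)
    fix x y
    have "dist (h x) (h y) = norm ((x - y) *\<^sub>R u)"
      by (simp add: h_def dist_norm algebra_simps)
    also have "\<dots> \<le> \<bar>x - y\<bar>" by (simp add: u_def norm_sgn)
    finally show "dist (h x) (h y) \<le> 1 * dist x y" by (simp add: dist_real_def)
  qed simp
  have hend: "h (l (Suc m)) = q (Suc m)"
    by (cases "q (Suc m) = q m")
       (simp_all add: h_def lSuc u_def sgn_div_norm dist_norm norm_minus_commute[of "q m"])
  define f where "f = (\<lambda>t. if t \<le> l m then g t else h t)"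
  have fL: "1-lipschitz_on {0..} f"
    unfolding f_def using g hL
    by (intro lipschitz_on_atLeast_concat) (auto intro: lipschitz_on_subset simp: h_def)
  \<comment> \<open>For coinciding vertices \<open>l (Suc m)\<close> equals \<open>l m\<close>, so
    that \<open>f\<close> still takes the branch of \<open>g\<close> there.\<close>
  have fend: "f (l (Suc m)) = q (Suc m)"
    using hend lSuc g(3) by (cases "q m = q (Suc m)") (auto simp: f_def)
  have "\<exists>s\<in>{0..l (Suc m)}. f s = q i" if "i \<le> Suc m" for i
  proof (cases "i = Suc m")
    case True
    thus ?thesis using fend l0 lSuc by (intro bexI[of _ "l (Suc m)"]) auto
  next
    case False
    hence "i \<le> m" using that by simp
    then obtain s where "s \<in> {0..l m}" "g s = q i" using g(4) by blast
    thus ?thesis using lSuc by (intro bexI[of _ s]) (auto simp: f_def intro: order_trans)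
  qed
  thus ?case using fL fend g(1) l0 by (intro exI[of _ f]) (auto simp: f_def)
qed

section \<open>Permutations, rotated placements and tours\<close>

text \<open>Turns visiting times into a visiting order. Ties occur when treasures coincide, hence
  monotonicity need not be strict.\<close>

lemma sorting_permutation:
  fixes s :: "nat \<Rightarrow> 'a::linorder"
  shows "\<exists>p. p permutes {1..k} \<and> mono_on {1..k} (s \<circ> p)"
proof -
  define xs where "xs = sort_key s [1..<Suc k]"
  have xs: "length xs = k" "set xs = {1..k}" "distinct xs" "sorted (map s xs)"
    unfolding xs_def by auto
  \<comment> \<open>List positions start at 0 and treasure numbers at 1; outside
    \<open>{1..k}\<close> the identity is forced by \<open>permutes\<close>.\<close>
  define p where "p = (\<lambda>i. if i \<in> {1..k} then xs ! (i - 1) else i)"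
  have "bij_betw (\<lambda>i. i - 1) {1..k} {..<k}"
    by (rule bij_betwI[where g = Suc]) auto
  moreover have "bij_betw ((!) xs) {..<k} {1..k}"
    using bij_betw_nth[OF xs(3), of "{..<k}" "{1..k}"] xs by simp
  ultimately have "bij_betw ((!) xs \<circ> (\<lambda>i. i - 1)) {1..k} {1..k}"
    by (rule bij_betw_trans)
  hence "bij_betw p {1..k} {1..k}"
    by (rule bij_betw_cong[THEN iffD1, rotated]) (simp add: p_def)
  hence "p permutes {1..k}" by (rule bij_imp_permutes) (auto simp: p_def)
  moreover have "mono_on {1..k} (s \<circ> p)"
  proof (rule mono_onI)
    fix a b assume ab: "a \<in> {1..k}" "b \<in> {1..k}" "a \<le> b"
    have "map s xs ! (a - 1) \<le> map s xs ! (b - 1)"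
      by (rule sorted_nth_mono) (use ab xs in auto)
    thus "(s \<circ> p) a \<le> (s \<circ> p) b" using ab xs by (simp add: p_def)
  qed
  ultimately show ?thesis by blast
qed

lemma placements_rotate:
  assumes "T \<in> placements k" "norm z = 1"
  shows "(\<lambda>j\<in>{1..k}. z * T j) \<in> placements k"
  using assms by (auto simp: placements_def norm_mult PiE_iff)

text \<open>Rotation by \<open>z\<close> is an isometry that takes \<open>inverse z\<close> to 1.
  This carries \<open>c k\<close>, defined with the start 1, over to any start on the
  circle.\<close>

lemma route_length_rotate:
  assumes "k \<ge> 1" "norm z = 1" "p permutes {1..k}"
  shows "route_length k (\<lambda>j\<in>{1..k}. z * T j) p =
    dist (inverse z) (T (p 1)) + (\<Sum>i=2..k. dist (T (p (i - 1))) (T (p i)))"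
proof -
  have mem: "p i \<in> {1..k}" if "i \<in> {1..k}" for i
    using that permutes_in_image[OF assms(3)] by blast
  have z: "dist (z * a) (z * b) = dist a b" for a b
    using assms(2) by (simp add: dist_norm norm_mult flip: right_diff_distrib)
  have "z \<noteq> 0" using assms(2) by auto
  hence "dist 1 (z * a) = dist (inverse z) a" for a
    using z[of "inverse z" a] by simp
  moreover have "(\<Sum>i=2..k. dist ((\<lambda>j\<in>{1..k}. z * T j) (p (i - 1))) ((\<lambda>j\<in>{1..k}. z * T j) (p i)))
     = (\<Sum>i=2..k. dist (T (p (i - 1))) (T (p i)))"
  proof (rule sum.cong)
    fix i assume "i \<in> {2..k}"
    hence "i - 1 \<in> {1..k}" "i \<in> {1..k}" by auto
    hence "p (i - 1) \<in> {1..k}" "p i \<in> {1..k}" using mem by blast+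
    thus "dist ((\<lambda>j\<in>{1..k}. z * T j) (p (i - 1))) ((\<lambda>j\<in>{1..k}. z * T j) (p i))
      = dist (T (p (i - 1))) (T (p i))" by (simp add: z)
  qed simp
  ultimately show ?thesis using mem[of 1] assms(1) by (simp add: route_length_def)
qed

lemma finite_route_lengths:
  "finite (route_length k T ` {p. p permutes {1..k}})"
  "route_length k T ` {p. p permutes {1..k}} \<noteq> {}"
  by (auto simp: finite_permutations intro: permutes_id exI)

text \<open>Each of the \<open>k\<close> legs is a chord of length at most 2. Boundedness is what
  makes the real supremum in \<open>c k\<close> an upper bound.\<close>

lemma bdd_above_route:
  assumes "k \<ge> 1"
  shows "bdd_above ((\<lambda>T. MIN p\<in>{p. p permutes {1..k}}. route_length k T p) ` placements k)"
proof (rule bdd_aboveI2)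
  fix T assume T: "T \<in> placements k"
  have nT: "norm (T j) = 1" if "j \<in> {1..k}" for j
    using T that by (auto simp: placements_def)
  have d: "dist a b \<le> 2" if "norm a = 1" "norm b = 1" for a b :: complex
    using norm_triangle_ineq4[of a b] that by (simp add: dist_norm)
  have "(MIN p\<in>{p. p permutes {1..k}}. route_length k T p) \<le> route_length k T id"
    using permutes_id by (intro Min_le finite_route_lengths) blast
  also have "\<dots> \<le> 2 + (\<Sum>i=2..k. 2)"
    unfolding route_length_def using assms by (intro add_mono sum_mono d nT) (auto intro!: d nT)
  finally show "(MIN p\<in>{p. p permutes {1..k}}. route_length k T p) \<le> 2 + (\<Sum>i=2..k. 2)" .
qed

text \<open>Rotate \<open>Q\<close> to 1. A shortest route through the rotated treasures has length
  at most \<open>c k\<close>, and the polygon through the original points in the same order,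
  starting at \<open>Q\<close>, has the same length.\<close>

lemma tour_from:
  assumes "k \<ge> 1" "T \<in> placements k" "norm Q = 1"
  shows "\<exists>g. g 0 = Q \<and> 1-lipschitz_on {0..} g \<and> (\<forall>j\<in>{1..k}. \<exists>s\<in>{0..c k}. g s = T j)"
proof -
  define T' where "T' = (\<lambda>j\<in>{1..k}. inverse Q * T j)"
  have Q: "norm (inverse Q) = 1" using assms(3) by (simp add: norm_inverse)
  have "T' \<in> placements k" unfolding T'_def by (rule placements_rotate[OF assms(2) Q])
  hence le: "(MIN p\<in>{p. p permutes {1..k}}. route_length k T' p) \<le> c k"
    unfolding c_def by (rule cSUP_upper[OF _ bdd_above_route[OF assms(1)]])
  obtain p where p: "p permutes {1..k}"
    "(MIN p\<in>{p. p permutes {1..k}}. route_length k T' p) = route_length k T' p"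
    using Min_in[OF finite_route_lengths, of k T'] by blast
  define q where "q = (\<lambda>i. if i = 0 then Q else T (p i))"
  define l where "l = (\<Sum>i<k. dist (q i) (q (Suc i)))"
  have "l = dist (q 0) (q 1) + (\<Sum>i=1..<k. dist (q i) (q (Suc i)))"
    using assms(1) by (simp add: l_def lessThan_atLeast0 sum.atLeast_Suc_lessThan)
  also have "(\<Sum>i=1..<k. dist (q i) (q (Suc i))) = (\<Sum>i=2..k. dist (T (p (i - 1))) (T (p i)))"
    by (rule sum.reindex_bij_witness[where i = "\<lambda>i. i - 1" and j = Suc]) (auto simp: q_def)
  finally have "l = route_length k T' p"
    using route_length_rotate[OF assms(1) Q p(1), of T] by (simp add: T'_def q_def)
  with le p have "l \<le> c k" by simp
  obtain g where g: "g 0 = q 0" "1-lipschitz_on {0..} g" "\<forall>i\<le>k. \<exists>s\<in>{0..l}. g s = q i"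
    using polygonal_path[of q k] unfolding l_def by blast
  have "\<exists>s\<in>{0..c k}. g s = T j" if j: "j \<in> {1..k}" for j
  proof -
    have "j \<in> p ` {1..k}" using permutes_image[OF p(1)] j by simp
    then obtain i where i: "i \<in> {1..k}" "p i = j" by (elim imageE) simp
    then obtain s where "s \<in> {0..l}" "g s = q i" using g(3) by auto
    thus ?thesis using i \<open>l \<le> c k\<close> by (intro bexI[of _ s]) (auto simp: q_def)
  qed
  thus ?thesis using g by (auto simp: q_def)
qed

section \<open>Upper bound: sweeping the circle\<close>

lemma sweep_covers:
  assumes "n \<ge> 1" "norm z = 1"
  shows "\<exists>i\<in>{1..n}. \<exists>u\<in>{0..2 * pi / n}. z = cis (2 * pi * (real i - 1) / n + u)"
proof -
  define \<theta> where "\<theta> = Arg2pi z"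
  have \<theta>: "0 \<le> \<theta>" "\<theta> < 2 * pi" "z = cis \<theta>"
    using Arg2pi[of z] assms(2) by (auto simp: \<theta>_def cis_conv_exp is_Arg_def)
  \<comment> \<open>The circle is cut into \<open>n\<close> arcs of length
    \<open>2 * pi / n\<close>; \<open>m\<close> numbers the one containing \<open>z\<close>, counted
    from 0. It is swept by robot \<open>Suc m\<close>.\<close>
  define m where "m = nat \<lfloor>\<theta> * n / (2 * pi)\<rfloor>"
  have "0 \<le> \<theta> * n / (2 * pi)" using \<theta> by simp
  hence m: "real m \<le> \<theta> * n / (2 * pi)" "\<theta> * n / (2 * pi) < real m + 1"
    unfolding m_def by linarith+
  have "\<theta> * n / (2 * pi) < n"
    using \<theta> assms(1) by (simp add: field_simps)
  hence "m < n" using m by linarith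
  moreover have "2 * pi * m / n \<le> \<theta>" "\<theta> \<le> 2 * pi * (m + 1) / n"
    using m assms(1) by (simp_all add: field_simps)
  hence "\<theta> - 2 * pi * m / n \<in> {0..2 * pi / n}"
    by (simp add: distrib_left add_divide_distrib)
  moreover have "z = cis (2 * pi * (real (Suc m) - 1) / n + (\<theta> - 2 * pi * m / n))"
    using \<theta> by simp
  ultimately show ?thesis by (intro bexI[of _ "Suc m"] bexI[of _ "\<theta> - 2 * pi * m / n"]) auto
qed

lemma rho_upper:
  assumes "n \<ge> 1" "k \<ge> 1"
  shows "rho n k \<le> ereal (1 + 2 * pi / n + c k)"
proof -
  \<comment> \<open>Time 1 for the radius and \<open>2 * pi / n\<close> for one arc.\<close>
  define D where "D = 1 + 2 * pi / n"
  define \<phi> where "\<phi> = (\<lambda>i::nat. 2 * pi * (real i - 1) / n)"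
  define A where "A = (\<lambda>i t. if t \<le> 1 then t *\<^sub>R cis (\<phi> i) else cis (\<phi> i + (t - 1)))"
  \<comment> \<open>The tour is specified, and then chosen in \<open>G\<close>, from the multiset of
    locations instead of \<open>T\<close>: robots learn where treasures are, not their numbers, and
    equal information must give equal motion.\<close>
  define tour where "tour = (\<lambda>Q (M::complex multiset) (g::real \<Rightarrow> complex).
    g 0 = Q \<and> 1-lipschitz_on {0..} g \<and> (\<forall>x\<in>#M. \<exists>s\<in>{0..c k}. g s = x))"
  define G where "G = (\<lambda>Q M. SOME g. tour Q M g)"
  define ms where "ms = (\<lambda>T::nat \<Rightarrow> complex. {#T j. j \<in># mset_set {1..k}#})"
  define S where "S = (\<lambda>T i t. if t \<le> D then A i t else G (A i D) (ms T) (t - D))"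
  have D: "D > 1" using assms by (simp add: D_def)
  have G: "tour (A i D) (ms T) (G (A i D) (ms T))" if T: "T \<in> placements k" for i T
  proof -
    have "norm (A i D) = 1" using D by (simp add: A_def)
    from tour_from[OF assms(2) T this]
    have "\<exists>g. tour (A i D) (ms T) g" by (simp add: tour_def ms_def)
    thus ?thesis unfolding G_def by (rule someI_ex)
  qed
  have AL: "1-lipschitz_on {0..} (A i)" for i
    unfolding A_def
  proof (rule lipschitz_on_atLeast_concat)
    show "1-lipschitz_on {0..1} (\<lambda>t. t *\<^sub>R cis (\<phi> i))"
      by (rule lipschitz_onI) (auto simp: dist_norm simp flip: scaleR_left_diff_distrib)
    show "1-lipschitz_on {1..} (\<lambda>t. cis (\<phi> i + (t - 1)))"
    proof (rule lipschitz_onI)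
      fix x y show "dist (cis (\<phi> i + (x - 1))) (cis (\<phi> i + (y - 1))) \<le> 1 * dist x y"
        using dist_cis_le[of "\<phi> i + (x - 1)" "\<phi> i + (y - 1)"] by (simp add: dist_real_def)
    qed simp
  qed simp
  have SL: "1-lipschitz_on {0..} (S T i)" if T: "T \<in> placements k" for T i
    unfolding S_def
  proof (rule lipschitz_on_atLeast_concat)
    show "1-lipschitz_on {0..D} (A i)" by (rule lipschitz_on_subset[OF AL]) auto
    have gL: "1-lipschitz_on {0..} (G (A i D) (ms T))" using G[OF T] by (simp add: tour_def)
    show "1-lipschitz_on {D..} (\<lambda>t. G (A i D) (ms T) (t - D))"
    proof (rule lipschitz_onI)
      fix x y assume "x \<in> {D..}" "y \<in> {D..}"
      thus "dist (G (A i D) (ms T) (x - D)) (G (A i D) (ms T) (y - D)) \<le> 1 * dist x y"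
        using lipschitz_onD[OF gL, of "x - D" "y - D"] by (simp add: dist_real_def)
    qed simp
    show "A i D = G (A i D) (ms T) (D - D)" using G[OF T] by (simp add: tour_def)
  qed
  have known_all: "known n k (S T) T D = ms T" if T: "T \<in> placements k" for T
  proof -
    have "\<exists>i\<in>{1..n}. \<exists>s\<in>{0..D}. S T i s = T j" if j: "j \<in> {1..k}" for j
    proof -
      have "norm (T j) = 1" using T j by (auto simp: placements_def)
      then obtain i u where iu: "i \<in> {1..n}" "u \<in> {0..2 * pi / n}" "T j = cis (\<phi> i + u)"
        using sweep_covers[OF assms(1)] unfolding \<phi>_def by blast
      moreover have "S T i (1 + u) = T j" using iu by (auto simp: S_def A_def D_def)
      ultimately show ?thesis by (intro bexI[of _ i] bexI[of _ "1 + u"]) (auto simp: D_def)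
    qed
    hence "{j \<in> {1..k}. \<exists>i\<in>{1..n}. \<exists>s\<in>{0..D}. S T i s = T j} = {1..k}" by blast
    thus ?thesis by (simp add: known_def ms_def)
  qed
  have "S \<in> strategies n k"
    unfolding strategies_def mem_Collect_eq
  proof (intro conjI ballI allI impI)
    fix T i assume "T \<in> placements k"
    show "S T i 0 = 0" using D by (simp add: S_def A_def)
    show "1-lipschitz_on {0..} (S T i)" by (rule SL) fact
  next
    fix T T' :: "nat \<Rightarrow> complex" and t :: real and i
    assume *: "T \<in> placements k" "T' \<in> placements k" "0 \<le> t"
      "\<forall>s\<in>{0..t}. known n k (S T) T s = known n k (S T') T' s"
    show "S T i t = S T' i t"
    \<comment> \<open>Up to time \<open>D\<close> the motion is the same for all placements. Later,
      equal histories agree at time \<open>D\<close> in particular, and there the known multiset is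
      already complete.\<close>
    proof (cases "t \<le> D")
      case False
      hence "ms T = ms T'" using * D known_all by (metis atLeastAtMost_iff less_eq_real_def
        linorder_not_le zero_less_one order.strict_trans)
      thus ?thesis by (simp add: S_def)
    qed (simp add: S_def)
  qed
  moreover have "completion_time n k (S T) T \<le> ereal (D + c k)" if T: "T \<in> placements k" for T
  proof -
    have vis: "\<exists>s\<in>{0..D + c k}. S T i s = T j" if "j \<in> {1..k}" for i j
    proof -
      have "T j \<in># ms T" using that by (simp add: ms_def)
      then obtain s where s: "s \<in> {0..c k}" "G (A i D) (ms T) s = T j"
        using G[OF T, of i] unfolding tour_def by blast
      have "G (A i D) (ms T) 0 = A i D" using G[OF T, of i] by (simp add: tour_def)
      \<comment> \<open>At \<open>s = 0\<close> the time \<open>D\<close> still belongs to the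
        sweep, which ends where the tour begins.\<close>
      hence "S T i (D + s) = T j" using s by (cases "s = 0") (auto simp: S_def)
      thus ?thesis using s D by (intro bexI[of _ "D + s"]) auto
    qed
    \<comment> \<open>An interval containing a visiting time is nonempty.\<close>
    moreover have "0 \<le> D + c k" using vis[of 1] assms(2) by fastforce
    ultimately show ?thesis unfolding completion_time_def by (intro Inf_lower) auto
  qed
  ultimately show ?thesis
    unfolding rho_def D_def by (intro INF_lower2[of S] SUP_least) (auto simp: add_ac)
qed

section \<open>Lower bound: the first visit to the circle\<close>

text \<open>By continuity, this is a finite union of closed preimages. Hence a first visit exists
  whenever there is a visit: the infimum is attained.\<close>

lemma closed_sphere_visits:
  assumes "S \<in> strategies n k" "T \<in> placements k"
  shows "closed {t \<in> {0..}. \<exists>i\<in>{1..n}. norm (S T i t) = 1}"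
proof -
  have "closed {t \<in> {0..}. norm (S T i t) = 1}" if "i \<in> {1..n}" for i
  proof -
    have "1-lipschitz_on {0..} (S T i)" using assms that by (auto simp: strategies_def)
    hence "continuous_on {0..} (\<lambda>t. norm (S T i t))"
      by (intro continuous_on_norm lipschitz_on_continuous_on)
    from continuous_closed_preimage_constant[OF this] show ?thesis by simp
  qed
  hence "closed (\<Union>i\<in>{1..n}. {t \<in> {0..}. norm (S T i t) = 1})" by (intro closed_UN) auto
  also have "(\<Union>i\<in>{1..n}. {t \<in> {0..}. norm (S T i t) = 1}) =
    {t \<in> {0..}. \<exists>i\<in>{1..n}. norm (S T i t) = 1}" by auto
  finally show ?thesis .
qed

lemma known_empty:
  assumes "T \<in> placements k" "\<And>i s. i \<in> {1..n} \<Longrightarrow> s \<in> {0..t} \<Longrightarrow> norm (X i s) \<noteq> 1"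
  shows "known n k X T t = {#}"
proof -
  have "{j \<in> {1..k}. \<exists>i\<in>{1..n}. \<exists>s\<in>{0..t}. X i s = T j} = {}"
    using assms by (fastforce simp: placements_def)
  thus ?thesis unfolding known_def by (metis image_mset_empty mset_set.empty)
qed

text \<open>All treasures lie on the circle, so before time \<open>t\<close> both histories are
  empty and the motions agree. At \<open>t\<close> itself the discoveries may differ, and agreement
  there comes from continuity.\<close>

lemma strategy_agree_upto:
  assumes S: "S \<in> strategies n k" and T: "T \<in> placements k" "T' \<in> placements k"
    and "0 \<le> t"
    and no: "\<And>U i s. U \<in> {T, T'} \<Longrightarrow> i \<in> {1..n} \<Longrightarrow> s \<in> {0..<t} \<Longrightarrow> norm (S U i s) \<noteq> 1"
    and i: "i \<in> {1..n}"
  shows "S T i t = S T' i t"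
proof (cases "t = 0")
  case True
  have "S U i 0 = 0" if "U \<in> placements k" for U
    using S i that unfolding strategies_def by blast
  thus ?thesis using True T by simp
next
  case False
  have eq: "S T i u = S T' i u" if u: "u \<in> {0..<t}" for u
  proof -
    have "known n k (S U) U s = {#}" if "s \<in> {0..u}" "U \<in> {T, T'}" for s U
    proof (rule known_empty)
      show "U \<in> placements k" using T that by blast
      fix i v assume "i \<in> {1..n}" "v \<in> {0..s}"
      thus "norm (S U i v) \<noteq> 1" using no[of U i v] that u by auto
    qed
    hence "\<forall>s\<in>{0..u}. known n k (S T) T s = known n k (S T') T' s" by simp
    moreover have "0 \<le> u" using u by simp
    ultimately show ?thesis using S T i unfolding strategies_def by blast
  qed
  have cont: "continuous_on {0..t} (S U i)" if "U \<in> {T, T'}" for U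
  proof -
    have "1-lipschitz_on {0..} (S U i)" using S T i that unfolding strategies_def by blast
    hence "1-lipschitz_on {0..t} (S U i)" by (rule lipschitz_on_subset) auto
    thus ?thesis by (rule lipschitz_on_continuous_on)
  qed
  have "closure {0..<t} = {0..t}" using False \<open>0 \<le> t\<close> by simp
  hence "norm (S T i t - S T' i t) \<le> 0"
    by (intro continuous_on_closure_norm_le[of "{0..<t}" "\<lambda>u. S T i u - S T' i u"])
       (use cont eq \<open>0 \<le> t\<close> in \<open>auto intro!: continuous_intros\<close>)
  thus ?thesis by simp
qed

text \<open>If the robots touched the circle earlier under \<open>T'\<close>, consider their first
  contact time. Up to and including it the motions for \<open>T\<close> and \<open>T'\<close> agree,
  so there would be an early contact under \<open>T\<close> as well.\<close>

lemma first_visit_independent: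
  assumes S: "S \<in> strategies n k" and T: "T \<in> placements k" "T' \<in> placements k"
    and \<tau>: "0 \<le> \<tau>"
    and no: "\<And>i s. i \<in> {1..n} \<Longrightarrow> s \<in> {0..<\<tau>} \<Longrightarrow> norm (S T i s) \<noteq> 1"
    and i: "i \<in> {1..n}" and s: "s \<in> {0..<\<tau>}"
  shows "norm (S T' i s) \<noteq> 1"
proof
  assume "norm (S T' i s) = 1"
  define H where "H = {t \<in> {0..}. \<exists>i\<in>{1..n}. norm (S T' i t) = 1}"
  have H: "closed H" "s \<in> H" "bdd_below H"
    using closed_sphere_visits[OF S T(2)] i s \<open>norm (S T' i s) = 1\<close>
    by (auto simp: H_def intro: bdd_belowI[of _ 0])
  define \<sigma> where "\<sigma> = Inf H"
  have "\<sigma> \<in> H" unfolding \<sigma>_def using H by (intro closed_contains_Inf) auto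
  moreover have "\<sigma> \<le> s" unfolding \<sigma>_def using H by (intro cInf_lower)
  moreover have low: "norm (S T' i u) \<noteq> 1" if "i \<in> {1..n}" "u \<in> {0..<\<sigma>}" for i u
  proof
    assume "norm (S T' i u) = 1"
    hence "u \<in> H" using that by (auto simp: H_def)
    hence "\<sigma> \<le> u" unfolding \<sigma>_def using H by (intro cInf_lower)
    thus False using that by simp
  qed
  ultimately obtain i' where i': "i' \<in> {1..n}" "norm (S T' i' \<sigma>) = 1" "0 \<le> \<sigma>" "\<sigma> < \<tau>"
    using s by (auto simp: H_def)
  have "S T i' \<sigma> = S T' i' \<sigma>"
    by (rule strategy_agree_upto[OF S T i'(3) _ i'(1)]) (use no low i' in auto)
  thus False using no[of i' \<sigma>] i' by auto
qed

text \<open>Order the treasures by visiting time. The time between consecutive visits is at least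
  the distance between the treasures, and these bounds telescope.\<close>

lemma visit_all_lower:
  fixes X :: "real \<Rightarrow> 'a::metric_space" and s :: "nat \<Rightarrow> real"
  assumes "k \<ge> 1" "1-lipschitz_on {0..} X" "0 \<le> \<tau>"
    and s: "\<And>j. j \<in> {1..k} \<Longrightarrow> s j \<in> {\<tau>..t} \<and> X (s j) = T j"
  shows "\<exists>p. p permutes {1..k} \<and>
    dist (X \<tau>) (T (p 1)) + (\<Sum>i=2..k. dist (T (p (i - 1))) (T (p i))) \<le> t - \<tau>"
proof -
  obtain p where p: "p permutes {1..k}" "mono_on {1..k} (s \<circ> p)"
    using sorting_permutation by blast
  have mem: "p i \<in> {1..k}" if "i \<in> {1..k}" for i
    using that permutes_in_image[OF p(1)] by blast
  have L: "dist (X a) (X b) \<le> b - a" if "0 \<le> a" "a \<le> b" for a b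
    using lipschitz_onD[OF assms(2), of a b] that by (auto simp: dist_real_def)
  have "dist (X \<tau>) (T (p 1)) + (\<Sum>i=2..m. dist (T (p (i - 1))) (T (p i))) \<le> s (p m) - \<tau>"
    if "1 \<le> m" "m \<le> k" for m
    using that
  proof (induction m rule: dec_induct)
    case base
    thus ?case using s[OF mem[of 1]] L[of \<tau> "s (p 1)"] assms(3) by auto
  next
    case (step m)
    have m: "m \<in> {1..k}" "Suc m \<in> {1..k}" using step by auto
    have "s (p m) \<le> s (p (Suc m))" using mono_onD[OF p(2), of m "Suc m"] m by simp
    hence "dist (T (p m)) (T (p (Suc m))) \<le> s (p (Suc m)) - s (p m)"
      using L[of "s (p m)" "s (p (Suc m))"] s[OF mem[OF m(1)]] s[OF mem[OF m(2)]] assms(3) by auto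
    thus ?case using step by (simp add: sum.cl_ivl_Suc)
  qed
  from this[of k] have "dist (X \<tau>) (T (p 1)) + (\<Sum>i=2..k. dist (T (p (i - 1))) (T (p i))) \<le> t - \<tau>"
    using s[OF mem[of k]] assms(1) by force
  thus ?thesis using p(1) by blast
qed

text \<open>The adversary answers with \<open>T\<close> rotated so that 1 goes to the point of first
  contact. The robot standing there then faces the same task as a robot at 1 facing
  \<open>T\<close>.\<close>

lemma completion_time_lower:
  assumes nk: "n \<ge> 1" "k \<ge> 1" and S: "S \<in> strategies n k" and T: "T \<in> placements k"
  shows "\<exists>U\<in>placements k.
    ereal (1 + (MIN p\<in>{p. p permutes {1..k}}. route_length k T p)) \<le> completion_time n k (S U) U"
proof -
  let ?H = "{t \<in> {0..}. \<exists>i\<in>{1..n}. norm (S T i t) = 1}"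
  show ?thesis
  proof (cases "?H = {}")
    \<comment> \<open>No robot ever reaches the circle, so no treasure is visited and the infimum of
      the empty set is infinite; \<open>T\<close> itself serves as witness.\<close>
    case True
    have "{ereal t |t. 0 \<le> t \<and> (\<forall>i\<in>{1..n}. \<forall>j\<in>{1..k}. \<exists>s\<in>{0..t}. S T i s = T j)} = {}"
    proof (rule ccontr)
      assume "\<not> ?thesis"
      then obtain s where "s \<ge> 0" "S T 1 s = T 1" using nk by fastforce
      moreover have "norm (T 1) = 1" using T nk by (auto simp: placements_def)
      ultimately have "s \<in> ?H" using nk by (auto intro!: bexI[of _ 1])
      thus False using True by blast
    qed
    hence "completion_time n k (S T) T = \<infinity>" unfolding completion_time_def
      by (metis Inf_empty top_ereal_def)
    thus ?thesis using T by (intro bexI[of _ T]) auto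
  next
    case False
    define \<tau> where "\<tau> = Inf ?H"
    have bdd: "bdd_below ?H" by (rule bdd_belowI[of _ 0]) auto
    have "\<tau> \<in> ?H"
      unfolding \<tau>_def by (rule closed_contains_Inf[OF False bdd closed_sphere_visits[OF S T]])
    then obtain r where r: "r \<in> {1..n}" "norm (S T r \<tau>) = 1" "0 \<le> \<tau>" by auto
    have no: "norm (S T i s) \<noteq> 1" if "i \<in> {1..n}" "s \<in> {0..<\<tau>}" for i s
    proof
      assume "norm (S T i s) = 1"
      hence "\<tau> \<le> s" unfolding \<tau>_def using that by (intro cInf_lower bdd) auto
      thus False using that by simp
    qed
    define P where "P = S T r \<tau>"
    \<comment> \<open>\<open>P\<close> is computed from the motion under \<open>T\<close>, but the
      motion under \<open>U\<close> is the same up to time \<open>\<tau>\<close>, so robot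
      \<open>r\<close> is at \<open>P\<close> then under \<open>U\<close> too.\<close>
    define U where "U = (\<lambda>j\<in>{1..k}. P * T j)"
    have P: "norm P = 1" "P \<noteq> 0" using r by (auto simp: P_def)
    have U: "U \<in> placements k" unfolding U_def by (rule placements_rotate[OF T P(1)])
    have no': "norm (S U i s) \<noteq> 1" if "i \<in> {1..n}" "s \<in> {0..<\<tau>}" for i s
      by (rule first_visit_independent[OF S T U r(3) no that])
    have SP: "S U r \<tau> = P"
      unfolding P_def
      by (rule strategy_agree_upto[OF S U T r(3) _ r(1)]) (use no no' in auto)
    have XL: "1-lipschitz_on {0..} (S U r)" "S U r 0 = 0"
      using S U r(1) unfolding strategies_def by blast+
    have "1 \<le> \<tau>" using lipschitz_onD[OF XL(1), of \<tau> 0] XL(2) SP P r by simp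
    have "ereal (1 + (MIN p\<in>{p. p permutes {1..k}}. route_length k T p)) \<le> completion_time n k (S U) U"
      unfolding completion_time_def
    proof (rule Inf_greatest)
      fix x assume "x \<in> {ereal t |t. 0 \<le> t \<and> (\<forall>i\<in>{1..n}. \<forall>j\<in>{1..k}. \<exists>s\<in>{0..t}. S U i s = U j)}"
      then obtain t where t: "x = ereal t" "\<forall>j\<in>{1..k}. \<exists>s\<in>{0..t}. S U r s = U j"
        using r by auto
      then obtain s where s: "\<And>j. j \<in> {1..k} \<Longrightarrow> s j \<in> {0..t} \<and> S U r (s j) = U j"
        by metis
      \<comment> \<open>Treasures lie on the circle, which nobody touches before
        \<open>\<tau>\<close>.\<close>
      have "s j \<in> {\<tau>..t} \<and> S U r (s j) = U j" if j: "j \<in> {1..k}" for j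
      proof -
        have "norm (U j) = 1" using U j by (auto simp: placements_def)
        thus ?thesis using no'[OF r(1), of "s j"] s[OF j] by force
      qed
      from visit_all_lower[where s = s, OF nk(2) XL(1) r(3) this]
      obtain p where p: "p permutes {1..k}"
        "dist P (U (p 1)) + (\<Sum>i=2..k. dist (U (p (i - 1))) (U (p i))) \<le> t - \<tau>"
        using SP by blast
      \<comment> \<open>Rotating back recovers \<open>T\<close> exactly, as placements are
        extensional functions.\<close>
      have "(\<lambda>j\<in>{1..k}. inverse P * U j) = T"
        using T P(2) by (auto simp: U_def placements_def PiE_iff extensional_def fun_eq_iff)
      hence "route_length k T p = dist P (U (p 1)) + (\<Sum>i=2..k. dist (U (p (i - 1))) (U (p i)))"
        using route_length_rotate[OF nk(2) _ p(1), of "inverse P" U] P by (simp add: norm_inverse)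
      moreover have "(MIN p\<in>{p. p permutes {1..k}}. route_length k T p) \<le> route_length k T p"
        using p(1) by (intro Min_le finite_route_lengths) auto
      ultimately show "ereal (1 + (MIN p\<in>{p. p permutes {1..k}}. route_length k T p)) \<le> x"
        using p(2) \<open>1 \<le> \<tau>\<close> t(1) by simp
    qed
    thus ?thesis using U by blast
  qed
qed

lemma rho_lower:
  assumes "n \<ge> 1" "k \<ge> 1"
  shows "ereal (1 + c k) \<le> rho n k"
  unfolding rho_def
proof (rule INF_greatest)
  fix S assume S: "S \<in> strategies n k"
  let ?v = "SUP T\<in>placements k. completion_time n k (S T) T"
  have ne: "placements k \<noteq> {}" by (auto simp: placements_def PiE_eq_empty_iff)
  have le: "ereal (1 + (MIN p\<in>{p. p permutes {1..k}}. route_length k T p)) \<le> ?v"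
    if "T \<in> placements k" for T
    using completion_time_lower[OF assms S that] by (blast intro: SUP_upper2)
  show "ereal (1 + c k) \<le> ?v"
  proof (cases ?v)
    \<comment> \<open>Here the pointwise bounds become real inequalities, as the real supremum
      \<open>c k\<close> requires.\<close>
    case (real v)
    have "c k \<le> v - 1"
      unfolding c_def by (rule cSUP_least[OF ne]) (use le real in fastforce)
    thus ?thesis using real by simp
  next
    case PInf
    thus ?thesis by simp
  next
    case MInf
    thus ?thesis using le ne by fastforce
  qed
qed

section \<open>The limit\<close>

theorem corollary15:
  fixes k :: nat
  assumes "k \<ge> 1"
  shows "(\<lambda>n. rho n k) \<longlonglongrightarrow> ereal (1 + c k)"
proof (rule tendsto_sandwich)
  show "\<forall>\<^sub>F n in sequentially. ereal (1 + c k) \<le> rho n k"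
    using eventually_ge_at_top[of 1] by eventually_elim (rule rho_lower[OF _ assms])
  show "\<forall>\<^sub>F n in sequentially. rho n k \<le> ereal (1 + 2 * pi / n + c k)"
    using eventually_ge_at_top[of 1] by eventually_elim (rule rho_upper[OF _ assms])
  have "(\<lambda>n. 1 + 2 * pi / real n + c k) \<longlonglongrightarrow> 1 + 0 + c k"
    by (intro tendsto_intros lim_const_over_n)
  thus "(\<lambda>n. ereal (1 + 2 * pi / real n + c k)) \<longlonglongrightarrow> ereal (1 + c k)" by simp
qed simp

end
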